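(* Let $\mathfrak{F}$ be a solvable subgroup-closed formation and let $G$ be a finite group. If $A$ is a solvable $\mathrm{K}\mathfrak{F}$-subnormal subgroup of $G$, then $A\le G_{\mathfrak{S}}$.
   Context: All groups are finite. A formation is a class $\mathfrak{F}$ of groups (closed under isomorphism) that is closed under quotients and such that $G/N_1, G/N_2\in\mathfrak{F}$ with $N_1,N_2\lhd G$ implies $G/(N_1\cap N_2)\in\mathfrak{F}$. It is subgroup-closed if every subgroup of a group in $\mathfrak{F}$ lies in $\mathfrak{F}$, and solvable if every group in $\mathfrak{F}$ is solvable. The $\mathfrak{F}$-residual $G^{\mathfrak{F}}$ of a group $G$ is the intersection of all normal subgroups $N$ of $G$ with $G/N\in\mathfrak{F}$. A subgroup $H$ of $G$ is $\mathrm{K}\mathfrak{F}$-subnormal in $G$ if there is a chain of subgroups $H=H_0\le H_1\le\dots\le H_n=G$ such that for every $i$ either $H_i$ is normal in $H_{i+1}$ or $H_{i+1}^{\mathfrak{F}}\le H_i$. $G_{\mathfrak{S}}$ denotes the solvable radical of $G$, i.e. the largest normal solvable subgroup of $G$. *)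

theory Defs
  imports "HOL-Algebra.Solvable_Groups" "HOL-Algebra.Zassenhaus"
begin

text \<open>
  A class of finite groups is given by its members with carrier in the natural numbers. Every
  finite group is isomorphic to such a group, so no class of finite groups (closed under
  isomorphism) is lost; a finite group over an arbitrary type belongs to the class if it is
  isomorphic to one of these members.
\<close>

definition group_class :: "nat monoid set \<Rightarrow> bool" where
  "group_class \<FF> \<longleftrightarrow>
     (\<forall>K\<in>\<FF>. group K \<and> finite (carrier K)) \<and>
     (\<forall>K\<in>\<FF>. \<forall>L :: nat monoid. group L \<longrightarrow> K \<cong> L \<longrightarrow> L \<in> \<FF>)"

definition in_class :: "('a, 'b) monoid_scheme \<Rightarrow> nat monoid set \<Rightarrow> bool" where
  "in_class G \<FF> \<longleftrightarrow> group G \<and> (\<exists>K\<in>\<FF>. K \<cong> G)"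

definition formation :: "nat monoid set \<Rightarrow> bool" where
  "formation \<FF> \<longleftrightarrow>
     group_class \<FF> \<and>
     (\<forall>K\<in>\<FF>. \<forall>N. N \<lhd> K \<longrightarrow> in_class (K Mod N) \<FF>) \<and>
     (\<forall>(K :: nat monoid) N1 N2.
        group K \<and> finite (carrier K) \<and> N1 \<lhd> K \<and> N2 \<lhd> K \<and>
        in_class (K Mod N1) \<FF> \<and> in_class (K Mod N2) \<FF> \<longrightarrow> in_class (K Mod (N1 \<inter> N2)) \<FF>)"

definition subgroup_closed :: "nat monoid set \<Rightarrow> bool" where
  "subgroup_closed \<FF> \<longleftrightarrow> (\<forall>K\<in>\<FF>. \<forall>H. subgroup H K \<longrightarrow> K\<lparr>carrier := H\<rparr> \<in> \<FF>)"

definition solvable_class :: "nat monoid set \<Rightarrow> bool" where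
  "solvable_class \<FF> \<longleftrightarrow> (\<forall>K\<in>\<FF>. solvable K)"

text \<open>
  The intersection is taken inside the group: for the empty class, the residual of a group is
  the whole group.
\<close>

definition residual :: "nat monoid set \<Rightarrow> ('a, 'b) monoid_scheme \<Rightarrow> 'a set" where
  "residual \<FF> G = carrier G \<inter> \<Inter>{N. N \<lhd> G \<and> in_class (G Mod N) \<FF>}"

definition KF_subnormal :: "nat monoid set \<Rightarrow> ('a, 'b) monoid_scheme \<Rightarrow> 'a set \<Rightarrow> bool" where
  "KF_subnormal \<FF> G A \<longleftrightarrow>
     (\<exists>(n :: nat) H.
        H 0 = A \<and> H n = carrier G \<and> (\<forall>i\<le>n. subgroup (H i) G) \<and>
        (\<forall>i<n. H i \<subseteq> H (Suc i) \<and>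
           (H i \<lhd> G\<lparr>carrier := H (Suc i)\<rparr> \<or>
            residual \<FF> (G\<lparr>carrier := H (Suc i)\<rparr>) \<subseteq> H i)))"

definition solvable_radical :: "('a, 'b) monoid_scheme \<Rightarrow> 'a set" where
  "solvable_radical G = (GREATEST N. N \<lhd> G \<and> solvable (G\<lparr>carrier := N\<rparr>))"

text \<open>In a finite group a largest normal solvable subgroup exists.\<close>

lemma (in group) solvable_carrier_update_iff:
  assumes "subgroup H G"
  shows "solvable (G\<lparr>carrier := H\<rparr>) \<longleftrightarrow> solvable_seq G H"
proof -
  interpret h: group_hom "G\<lparr>carrier := H\<rparr>" G "\<lambda>x. x"
    using subgroup.subset[OF assms] subgroup.subgroup_is_group[OF assms is_group] is_group
    by (auto simp: group_hom_def group_hom_axioms_def hom_def)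
  show ?thesis
    using h.solvable_imp_solvable_img[of H] h.solvable_img_imp_solvable[of H] h.G.subgroup_self
    by (auto simp: solvable_def)
qed

lemma (in group) normal_solvable_set_mult:
  assumes M: "M \<lhd> G" "solvable (G\<lparr>carrier := M\<rparr>)"
    and N: "N \<lhd> G" "solvable (G\<lparr>carrier := N\<rparr>)"
  shows "N <#> M \<lhd> G" "solvable (G\<lparr>carrier := N <#> M\<rparr>)"
proof -
  interpret M: normal M G by fact
  interpret N: normal N G by fact
  interpret Q: group "G Mod N" by (rule N.factorgroup_is_group)
  have sub: "subgroup (N <#> M) G"
    using mult_norm_subgroup N(1) M.subgroup_axioms by blast
  have "x \<otimes> (n \<otimes> m) \<otimes> inv x \<in> N <#> M" if "x \<in> carrier G" "n \<in> N" "m \<in> M" for x n m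
  proof -
    have "x \<otimes> (n \<otimes> m) \<otimes> inv x = (x \<otimes> n \<otimes> inv x) \<otimes> (x \<otimes> m \<otimes> inv x)"
      using that by (simp add: m_assoc inv_solve_left)
    moreover have "x \<otimes> n \<otimes> inv x \<in> N" "x \<otimes> m \<otimes> inv x \<in> M"
      using that N.inv_op_closed2 M.inv_op_closed2 by auto
    ultimately show ?thesis
      unfolding set_mult_def by auto
  qed
  then show "N <#> M \<lhd> G"
    unfolding normal_inv_iff using sub by (auto simp: set_mult_def)
  interpret q: group_hom G "G Mod N" "\<lambda>x. N #> x"
    using N.r_coset_hom_Mod is_group Q.is_group
    by (auto simp: group_hom_def group_hom_axioms_def)
  have coset: "N #> (n \<otimes> m) = N #> m" if "n \<in> N" "m \<in> M" for n m
    using that coset_mult_assoc[of N n m] N.rcos_const[OF is_group] N.subset by auto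
  have img: "(\<lambda>x. N #> x) ` (N <#> M) = (\<lambda>x. N #> x) ` M"
  proof (intro equalityI subsetI)
    fix X assume "X \<in> (\<lambda>x. N #> x) ` (N <#> M)"
    then obtain n m where "n \<in> N" "m \<in> M" "X = N #> (n \<otimes> m)"
      unfolding set_mult_def by auto
    then show "X \<in> (\<lambda>x. N #> x) ` M"
      using coset by simp
  next
    fix X assume "X \<in> (\<lambda>x. N #> x) ` M"
    then obtain m where m: "m \<in> M" "X = N #> m" by auto
    then have "\<one> \<otimes> m \<in> N <#> M"
      using N.one_closed unfolding set_mult_def by blast
    then show "X \<in> (\<lambda>x. N #> x) ` (N <#> M)"
      using m by simp
  qed
  have ker: "kernel G (G Mod N) (\<lambda>x. N #> x) \<subseteq> (\<lambda>x. x) ` N"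
    using coset_join1[OF _ _ N.subgroup_axioms] N.subset by (auto simp: kernel_def)
  have "N \<subseteq> N <#> M"
  proof
    fix n assume n: "n \<in> N"
    have "n \<otimes> \<one> \<in> N <#> M"
      using n M.one_closed unfolding set_mult_def by blast
    moreover have "n \<otimes> \<one> = n"
      using n N.subset by auto
    ultimately show "n \<in> N <#> M" by simp
  qed
  moreover have "group_hom G G (\<lambda>x. x)"
    using is_group by (auto simp: group_hom_def group_hom_axioms_def hom_def)
  moreover have "solvable_seq (G Mod N) ((\<lambda>x. N #> x) ` (N <#> M))"
    unfolding img
    using q.solvable_imp_solvable_img[of M] M(2) solvable_carrier_update_iff[OF M.subgroup_axioms]
    by simp
  ultimately have "solvable_seq G (N <#> M)"
    using solvable_seq_condition[of G G "\<lambda>x. x" "G Mod N" "\<lambda>x. N #> x" N "N <#> M"]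
      q.group_hom_axioms ker sub N(2) solvable_carrier_update_iff[OF N.subgroup_axioms] by simp
  then show "solvable (G\<lparr>carrier := N <#> M\<rparr>)"
    using solvable_carrier_update_iff[OF sub] by simp
qed

lemma (in group) solvable_radical_greatest:
  assumes "finite (carrier G)"
  shows "solvable_radical G \<lhd> G"
    and "solvable (G\<lparr>carrier := solvable_radical G\<rparr>)"
    and "\<And>N. N \<lhd> G \<Longrightarrow> solvable (G\<lparr>carrier := N\<rparr>) \<Longrightarrow> N \<subseteq> solvable_radical G"
proof -
  define P where "P N \<longleftrightarrow> N \<lhd> G \<and> solvable (G\<lparr>carrier := N\<rparr>)" for N
  have in_carrier: "N \<subseteq> carrier G" if "P N" for N
    using that normal_imp_subgroup subgroup.subset unfolding P_def by blast
  have "P {\<one>}"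
    using one_is_normal solvable_seq.unity solvable_carrier_update_iff normal_imp_subgroup
    unfolding P_def by blast
  moreover have "finite {N. P N}"
    using finite_subset[of "{N. P N}" "Pow (carrier G)"] assms in_carrier by auto
  ultimately obtain R where R: "P R" "\<And>N. P N \<Longrightarrow> R \<subseteq> N \<Longrightarrow> R = N"
    using finite_has_maximal[of "{N. P N}"] by auto
  have top: "N \<subseteq> R" if "P N" for N
  proof -
    have "P (R <#> N)"
      using normal_solvable_set_mult R(1) that unfolding P_def by blast
    moreover have "\<one> \<in> R" "\<one> \<in> N"
      using R(1) that normal_imp_subgroup subgroup.one_closed unfolding P_def by blast+
    then have "R \<subseteq> R <#> N" "N \<subseteq> R <#> N"
      using in_carrier[OF R(1)] in_carrier[OF that] unfolding set_mult_def by force+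
    ultimately show ?thesis using R(2) by blast
  qed
  have "solvable_radical G = R"
    unfolding solvable_radical_def P_def[symmetric]
    by (rule Greatest_equality) (use R(1) top in auto)
  then show "solvable_radical G \<lhd> G" "solvable (G\<lparr>carrier := solvable_radical G\<rparr>)"
    and "\<And>N. N \<lhd> G \<Longrightarrow> solvable (G\<lparr>carrier := N\<rparr>) \<Longrightarrow> N \<subseteq> solvable_radical G"
    using R(1) top unfolding P_def by blast+
qed

end

theory Submission
  imports Defs
begin

text \<open>
  The idea is to push solvability up a chain \<open>A = H\<^sub>0 \<le> \<dots> \<le> H\<^sub>n = G\<close> witnessing
  \<open>KF_subnormal\<close>: by induction on \<open>i\<close>, \<open>A\<close> lies in the solvable radical of \<open>H\<^sub>i\<close>. At \<open>i = 0\<close> this is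
  the solvability of \<open>A\<close>, and at \<open>i = n\<close> it is the theorem. For one step, write \<open>H \<le> K\<close> for
  consecutive members of the chain; it suffices that the radical of \<open>H\<close> lies in that of \<open>K\<close>.

  If \<open>H\<close> is normal in \<open>K\<close>, its radical is characteristic in \<open>H\<close>, hence a solvable normal subgroup
  of \<open>K\<close> (lemma \<open>solvable_radical_of_normal\<close>).

  Otherwise \<open>H\<close> contains the residual \<open>D\<close> of \<open>K\<close>. What matters about \<open>D\<close> is that it is normal in
  \<open>K\<close> and contains a term of the derived series of \<open>K\<close>: every normal \<open>N\<close> with \<open>K/N\<close> in the class
  contains one, because \<open>K/N\<close> is solvable, and only finitely many \<open>N\<close> are intersected
  (lemma \<open>residual_contains_derived\<close>). Let \<open>S\<close> be the radical of \<open>D\<close>, which is normal in \<open>K\<close>, and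
  let \<open>C\<close> be the centralizer of \<open>D\<close> modulo \<open>S\<close>, that is, the set of all \<open>x \<in> K\<close> with
  \<open>[x, D] \<subseteq> S\<close>. It is normal in \<open>K\<close>, and it is solvable: some derived subgroup of \<open>C\<close> lies in
  \<open>C \<inter> D\<close>, the next one lies in \<open>S\<close>, and \<open>S\<close> is solvable. Finally, the radical \<open>R\<close> of \<open>H\<close> lies in
  \<open>C\<close>: both \<open>R\<close> and \<open>D\<close> are normal in \<open>H\<close>, so \<open>[R, D] \<subseteq> R \<inter> D\<close>, and \<open>R \<inter> D\<close> is a solvable
  normal subgroup of \<open>D\<close>, hence contained in \<open>S\<close>. So \<open>R \<le> C\<close> is contained in the radical of \<open>K\<close>.
\<close>

section \<open>Derived series\<close>

lemma (in group) exp_of_derived_antimono: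
  assumes "m \<le> n" "subgroup H G"
  shows "(derived G ^^ n) H \<subseteq> (derived G ^^ m) H"
proof -
  have "(derived G ^^ k) H \<subseteq> H" for k
    using derived_incl[OF _ assms(2)] by (induct k) auto
  moreover have "(derived G ^^ n) H = (derived G ^^ m) ((derived G ^^ (n - m)) H)"
    using assms(1) by (metis comp_apply funpow_add le_add_diff_inverse)
  ultimately show ?thesis
    using mono_exp_of_derived by simp
qed

lemma (in group) solvable_seq_if_exp_of_derived_subset:
  assumes "subgroup H G" "solvable_seq G S" "(derived G ^^ n) H \<subseteq> S"
  shows "solvable_seq G H"
proof -
  obtain k where k: "(derived G ^^ k) S = {\<one>}"
    using solvable_imp_trivial_derived_seq assms(2) by blast
  have "(derived G ^^ (k + n)) H \<subseteq> {\<one>}"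
    using mono_exp_of_derived[OF assms(3), of k] k by (simp add: funpow_add)
  moreover have "\<one> \<in> (derived G ^^ (k + n)) H"
    using subgroup.one_closed exp_of_derived_is_subgroup assms(1) by blast
  ultimately show ?thesis
    using trivial_derived_seq_imp_solvable[OF assms(1), of "k + n"] by blast
qed

section \<open>Residuals\<close>

lemma (in group) residual_normal: "residual \<FF> G \<lhd> G"
proof -
  let ?I = "insert (carrier G) {N. N \<lhd> G \<and> in_class (G Mod N) \<FF>}"
  have eq: "residual \<FF> G = \<Inter>?I"
    by (auto simp: residual_def)
  have I: "N \<lhd> G" if "N \<in> ?I" for N
    using that normal_self by auto
  show ?thesis
    unfolding eq
  proof (rule normal_invI)
    show "subgroup (\<Inter>?I) G"
      using I normal_imp_subgroup by (intro subgroups_Inter) auto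
    show "x \<otimes> h \<otimes> inv x \<in> \<Inter>?I" if "x \<in> carrier G" "h \<in> \<Inter>?I" for x h
    proof (rule InterI)
      fix N assume N: "N \<in> ?I"
      then have "h \<in> N"
        using that(2) by (rule InterD[rotated])
      then show "x \<otimes> h \<otimes> inv x \<in> N"
        using normal_invE(2)[OF I[OF N] that(1)] by simp
    qed
  qed
qed

lemma (in group) derived_series_in_normal_if_solvable_quotient:
  assumes "N \<lhd> G" "solvable (G Mod N)"
  shows "\<exists>n. (derived G ^^ n) (carrier G) \<subseteq> N"
proof -
  interpret N: normal N G by fact
  interpret Q: group "G Mod N" by (rule N.factorgroup_is_group)
  interpret q: group_hom G "G Mod N" "\<lambda>x. N #> x"
    using N.r_coset_hom_Mod by unfold_locales
  obtain n where "(derived (G Mod N) ^^ n) (carrier (G Mod N)) = {\<one>\<^bsub>G Mod N\<^esub>}"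
    using Q.solvable_iff_trivial_derived_seq assms(2) by blast
  moreover have "carrier (G Mod N) = (\<lambda>x. N #> x) ` carrier G"
    by (auto simp: FactGroup_def RCOSETS_def)
  ultimately have img: "(\<lambda>x. N #> x) ` (derived G ^^ n) (carrier G) = {N}"
    using q.exp_of_derived_img[of "carrier G" n] by (simp add: FactGroup_def)
  have "x \<in> N" if "x \<in> (derived G ^^ n) (carrier G)" for x
    using that img exp_of_derived_in_carrier[of "carrier G" n]
      coset_join1[of N x] N.subset N.subgroup_axioms by blast
  then show ?thesis by blast
qed

lemma in_solvable_class_imp_solvable:
  assumes "group_class \<FF>" "solvable_class \<FF>" "in_class Q \<FF>"
  shows "solvable Q"
proof -
  obtain K f where K: "K \<in> \<FF>" and f: "f \<in> iso K Q"
    using assms(3) by (auto simp: in_class_def is_iso_def)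
  have "group_hom K Q f"
    using K f assms(1,3) iso_imp_homomorphism
    unfolding group_hom_def group_hom_axioms_def group_class_def in_class_def by blast
  then show ?thesis
    using group_hom.surj_hom_imp_solvable[of K Q f] assms(2) K f
    by (simp add: solvable_class_def iso_def bij_betw_def)
qed

text \<open>Finiteness turns one derived length for each quotient into a common one.\<close>

lemma (in group) residual_contains_derived:
  assumes "finite (carrier G)" "group_class \<FF>" "solvable_class \<FF>"
  shows "\<exists>m. (derived G ^^ m) (carrier G) \<subseteq> residual \<FF> G"
proof -
  let ?\<N> = "{N. N \<lhd> G \<and> in_class (G Mod N) \<FF>}"
  have "?\<N> \<subseteq> Pow (carrier G)"
    using normal_imp_subgroup subgroup.subset by blast
  then have fin: "finite ?\<N>"
    using assms(1) finite_subset by blast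
  have "\<forall>N\<in>?\<N>. \<exists>n. (derived G ^^ n) (carrier G) \<subseteq> N"
    using derived_series_in_normal_if_solvable_quotient in_solvable_class_imp_solvable assms(2,3)
    by blast
  then obtain l where l: "\<And>N. N \<in> ?\<N> \<Longrightarrow> (derived G ^^ l N) (carrier G) \<subseteq> N"
    by metis
  let ?m = "\<Sum>N\<in>?\<N>. l N"
  have "(derived G ^^ ?m) (carrier G) \<subseteq> N" if "N \<in> ?\<N>" for N
  proof -
    have "l N \<le> ?m"
      using fin that by (intro member_le_sum) auto
    then show ?thesis
      using exp_of_derived_antimono[OF _ subgroup_self] l[OF that] by blast
  qed
  moreover have "(derived G ^^ ?m) (carrier G) \<subseteq> carrier G"
    by (rule exp_of_derived_in_carrier) simp
  ultimately show ?thesis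
    unfolding residual_def by blast
qed

section \<open>Radicals of normal subgroups\<close>

text \<open>
  Conjugation by an element of the group is an automorphism of \<open>N\<close>, so it maps the radical of \<open>N\<close>
  to another solvable normal subgroup of \<open>N\<close>.
\<close>

lemma (in group) solvable_radical_of_normal:
  assumes fin: "finite (carrier G)" and N: "N \<lhd> G"
  shows "solvable_radical (G\<lparr>carrier := N\<rparr>) \<lhd> G"
    and "solvable (G\<lparr>carrier := solvable_radical (G\<lparr>carrier := N\<rparr>)\<rparr>)"
proof -
  interpret N: normal N G by fact
  let ?N = "G\<lparr>carrier := N\<rparr>"
  let ?S = "solvable_radical ?N"
  interpret gN: group ?N
    by (rule N.subgroup_is_group[OF is_group])
  have finN: "finite (carrier ?N)"
    using fin N.subset finite_subset by auto
  note S = gN.solvable_radical_greatest[OF finN]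
  have SN: "?S \<subseteq> N"
    using subgroup.subset[OF normal_imp_subgroup[OF S(1)]] by simp
  show solv: "solvable (G\<lparr>carrier := ?S\<rparr>)"
    using S(2) by simp
  show "?S \<lhd> G"
  proof (rule normal_invI)
    show "subgroup ?S G"
      using incl_subgroup[OF N.subgroup_axioms normal_imp_subgroup[OF S(1)]] .
    fix x s assume x: "x \<in> carrier G" and s: "s \<in> ?S"
    let ?c = "\<lambda>y. x \<otimes> y \<otimes> inv x"
    have hom: "?c \<in> hom ?N ?N"
      using x N.inv_op_closed2 by (auto simp: hom_def m_assoc inv_solve_left)
    have surj: "?c ` N = N"
    proof (intro equalityI subsetI)
      fix y assume y: "y \<in> N"
      then have "x \<otimes> (inv x \<otimes> y) = y"
        using x by (simp add: m_assoc[symmetric])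
      then have "inv x \<otimes> y \<otimes> x \<in> N" "y = ?c (inv x \<otimes> y \<otimes> x)"
        using x y N.inv_op_closed1 by (auto simp: m_assoc)
      then show "y \<in> ?c ` N" by blast
    qed (use x N.inv_op_closed2 in auto)
    interpret c: group_hom ?N ?N ?c
      using hom by unfold_locales
    have "?c ` ?S \<lhd> ?N"
      using normal.surj_hom_normal_subgroup[OF S(1) c.group_hom_axioms] surj by simp
    moreover have "solvable_seq ?N (?c ` ?S)"
      using c.solvable_imp_solvable_img S(2)
        gN.solvable_carrier_update_iff[OF normal_imp_subgroup[OF S(1)]] by blast
    ultimately have "?c ` ?S \<subseteq> ?S"
      using S(3) gN.solvable_carrier_update_iff normal_imp_subgroup by blast
    then show "?c s \<in> ?S"
      using s by blast
  qed
qed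

section \<open>Centralizers modulo a normal subgroup\<close>

text \<open>
  For the projection \<open>h\<close> of a group onto its quotient by a normal subgroup \<open>S\<close>, the set below is the
  centralizer of \<open>D\<close> modulo \<open>S\<close>.
\<close>

lemma (in group_hom) normal_relative_centralizer:
  assumes "D \<lhd> G"
  shows "{x \<in> carrier G. \<forall>d\<in>D. h x \<otimes>\<^bsub>H\<^esub> h d = h d \<otimes>\<^bsub>H\<^esub> h x} \<lhd> G" (is "?C \<lhd> G")
proof -
  interpret D: normal D G by fact
  have C_iff: "x \<in> ?C \<longleftrightarrow> x \<in> carrier G \<and> (\<forall>d\<in>D. h (x \<otimes> d) = h (d \<otimes> x))" for x
    using D.mem_carrier by auto
  have mult: "x \<otimes> y \<in> ?C" if x: "x \<in> ?C" and y: "y \<in> ?C" for x y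
  proof -
    have "h ((x \<otimes> y) \<otimes> d) = h (d \<otimes> (x \<otimes> y))" if d: "d \<in> D" for d
    proof -
      have car: "x \<in> carrier G" "y \<in> carrier G" "d \<in> carrier G"
        using x y d D.mem_carrier by auto
      have "h ((x \<otimes> y) \<otimes> d) = h x \<otimes>\<^bsub>H\<^esub> h (y \<otimes> d)"
        using car by (simp add: H.m_assoc)
      also have "\<dots> = h x \<otimes>\<^bsub>H\<^esub> h (d \<otimes> y)"
        using y d C_iff[of y] by metis
      also have "\<dots> = h (x \<otimes> d) \<otimes>\<^bsub>H\<^esub> h y"
        using car by (simp add: H.m_assoc)
      also have "\<dots> = h (d \<otimes> x) \<otimes>\<^bsub>H\<^esub> h y"
        using x d C_iff[of x] by metis
      also have "\<dots> = h (d \<otimes> (x \<otimes> y))"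
        using car by (simp add: H.m_assoc)
      finally show ?thesis .
    qed
    then show ?thesis
      using x y unfolding C_iff by blast
  qed
  have inv: "inv x \<in> ?C" if x: "x \<in> ?C" for x
  proof -
    have "h (inv x \<otimes> d) = h (d \<otimes> inv x)" if d: "d \<in> D" for d
    proof -
      have car: "x \<in> carrier G" "d \<in> carrier G"
        using x d D.mem_carrier by auto
      have "h (inv x \<otimes> d) = h (inv x \<otimes> (d \<otimes> x) \<otimes> inv x)"
        using car by (simp add: G.m_assoc del: hom_mult)
      also have "\<dots> = h (inv x) \<otimes>\<^bsub>H\<^esub> h (d \<otimes> x) \<otimes>\<^bsub>H\<^esub> h (inv x)"
        using car by (metis G.inv_closed G.m_closed hom_mult)
      also have "\<dots> = h (inv x) \<otimes>\<^bsub>H\<^esub> h (x \<otimes> d) \<otimes>\<^bsub>H\<^esub> h (inv x)"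
        using x d C_iff[of x] by metis
      also have "\<dots> = h (inv x \<otimes> (x \<otimes> d) \<otimes> inv x)"
        using car by (metis G.inv_closed G.m_closed hom_mult)
      also have "\<dots> = h (d \<otimes> inv x)"
        using car by (simp add: G.m_assoc[symmetric] del: hom_mult)
      finally show ?thesis .
    qed
    then show ?thesis
      using x unfolding C_iff by blast
  qed
  show ?thesis
  proof (rule G.normal_invI)
    show "subgroup ?C G"
      using mult inv D.mem_carrier by (intro G.subgroupI) auto
    fix g x assume g: "g \<in> carrier G" and x: "x \<in> ?C"
    have "h (g \<otimes> x \<otimes> inv g) \<otimes>\<^bsub>H\<^esub> h d = h d \<otimes>\<^bsub>H\<^esub> h (g \<otimes> x \<otimes> inv g)" if d: "d \<in> D" for d
    proof -
      define e where "e = inv g \<otimes> d \<otimes> g"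
      have e: "e \<in> D" "e \<in> carrier G"
        using D.inv_op_closed1[OF g d] D.mem_carrier unfolding e_def by auto
      have "g \<otimes> (inv g \<otimes> d) = d"
        using g d D.mem_carrier by (simp add: G.m_assoc[symmetric])
      then have d_eq: "d = g \<otimes> e \<otimes> inv g"
        using g d D.mem_carrier unfolding e_def by (simp add: G.m_assoc)
      have conj: "(g \<otimes> y \<otimes> inv g) \<otimes> (g \<otimes> z \<otimes> inv g) = g \<otimes> (y \<otimes> z) \<otimes> inv g"
        if "y \<in> carrier G" "z \<in> carrier G" for y z
      proof -
        have "inv g \<otimes> (g \<otimes> (z \<otimes> inv g)) = z \<otimes> inv g"
          using that g by (simp add: G.m_assoc[symmetric])
        then show ?thesis
          using that g by (simp add: G.m_assoc)
      qed
      have "h (x \<otimes> e) = h (e \<otimes> x)"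
        using x e by simp
      then have "h ((g \<otimes> x \<otimes> inv g) \<otimes> d) = h (d \<otimes> (g \<otimes> x \<otimes> inv g))"
        using g x e by (simp add: d_eq conj)
      then show ?thesis
        using g x d D.mem_carrier by simp
    qed
    then show "g \<otimes> x \<otimes> inv g \<in> ?C"
      using g x by auto
  qed
qed

text \<open>
  The derived series of \<open>C\<close> reaches \<open>C \<inter> D\<close>; there \<open>h\<close> sends all commutators to \<open>\<one>\<close>, so one
  more step reaches the kernel.
\<close>

lemma (in group_hom) solvable_relative_centralizer:
  assumes D: "D \<lhd> G" and der: "(derived G ^^ m) (carrier G) \<subseteq> D"
    and ker: "solvable_seq G (kernel G H h)"
  shows "solvable_seq G {x \<in> carrier G. \<forall>d\<in>D. h x \<otimes>\<^bsub>H\<^esub> h d = h d \<otimes>\<^bsub>H\<^esub> h x}"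
    (is "solvable_seq G ?C")
proof (rule G.solvable_seq_if_exp_of_derived_subset)
  show C: "subgroup ?C G"
    using normal_relative_centralizer[OF D] normal_imp_subgroup by blast
  have "(derived G ^^ m) ?C \<subseteq> D"
    using G.mono_exp_of_derived[OF subgroup.subset[OF C]] der by blast
  moreover have "(derived G ^^ m) ?C \<subseteq> ?C"
    using G.exp_of_derived_antimono[OF le0 C, of m] by simp
  ultimately have "(derived G ^^ m) ?C \<subseteq> ?C \<inter> D"
    by blast
  then have "(derived G ^^ Suc m) ?C \<subseteq> derived G (?C \<inter> D)"
    using G.mono_derived by simp
  also have "\<dots> \<subseteq> kernel G H h"
    unfolding derived_def
  proof (rule G.generate_subgroup_incl[OF _ subgroup_kernel], clarify)
    fix a b assume "a \<in> D" "b \<in> D" "a \<in> carrier G" "b \<in> carrier G"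
      and "\<forall>d\<in>D. h a \<otimes>\<^bsub>H\<^esub> h d = h d \<otimes>\<^bsub>H\<^esub> h a"
    then have "h (a \<otimes> b) = h (b \<otimes> a)" "a \<in> carrier G" "b \<in> carrier G"
      by simp_all
    then have "h (a \<otimes> b \<otimes> inv a \<otimes> inv b) = h (b \<otimes> a \<otimes> inv a \<otimes> inv b)"
      by (metis G.inv_closed G.m_closed hom_mult)
    also have "\<dots> = \<one>\<^bsub>H\<^esub>"
      using \<open>a \<in> carrier G\<close> \<open>b \<in> carrier G\<close> by (simp add: G.m_assoc)
    finally show "a \<otimes> b \<otimes> inv a \<otimes> inv b \<in> kernel G H h"
      using \<open>a \<in> carrier G\<close> \<open>b \<in> carrier G\<close> by (simp add: kernel_def)
  qed
  finally show "(derived G ^^ Suc m) ?C \<subseteq> kernel G H h" .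
qed (rule ker)

section \<open>Radicals of subgroups above a derived subgroup\<close>

text \<open>
  The radical of \<open>H\<close> centralizes \<open>D\<close> modulo the radical of \<open>D\<close>, and all of that relative centralizer
  is solvable and normal.
\<close>

lemma (in group) solvable_radical_mono_above_derived:
  assumes fin: "finite (carrier G)" and D: "D \<lhd> G" and DH: "D \<subseteq> H" and H: "subgroup H G"
    and der: "(derived G ^^ m) (carrier G) \<subseteq> D"
  shows "solvable_radical (G\<lparr>carrier := H\<rparr>) \<subseteq> solvable_radical G"
proof -
  interpret D: normal D G by fact
  interpret H: subgroup H G by fact
  let ?D = "G\<lparr>carrier := D\<rparr>" and ?H = "G\<lparr>carrier := H\<rparr>"
  interpret gD: group ?D by (rule D.subgroup_is_group[OF is_group])
  interpret gH: group ?H by (rule H.subgroup_is_group[OF is_group])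
  define S where "S = solvable_radical ?D"
  define R where "R = solvable_radical ?H"
  have finD: "finite (carrier ?D)" and finH: "finite (carrier ?H)"
    using fin D.subset H.subset finite_subset by auto
  have S: "S \<lhd> G" "solvable (G\<lparr>carrier := S\<rparr>)"
    using solvable_radical_of_normal[OF fin D] unfolding S_def by auto
  have R: "R \<lhd> ?H" and solvR: "solvable (G\<lparr>carrier := R\<rparr>)"
    using gH.solvable_radical_greatest(1,2)[OF finH] unfolding R_def by auto
  have R_sub: "subgroup R G"
    using incl_subgroup[OF H normal_imp_subgroup[OF R]] .
  have RH: "R \<subseteq> H"
    using subgroup.subset[OF normal_imp_subgroup[OF R]] by simp
  have RD: "R \<inter> D \<subseteq> S"
  proof -
    have "D \<inter> R \<lhd> ?D"
      using normal_inter[OF H D.subgroup_axioms R] DH by (simp add: Int_absorb1 Int_absorb2 Int_commute)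
    then have norm: "R \<inter> D \<lhd> ?D"
      by (simp add: Int_commute)
    have sub: "subgroup (R \<inter> D) G"
      using subgroups_Inter_pair R_sub D.subgroup_axioms by blast
    have "(derived G ^^ 0) (R \<inter> D) \<subseteq> R"
      by simp
    then have "solvable_seq G (R \<inter> D)"
      using solvable_seq_if_exp_of_derived_subset[OF sub] solvR solvable_carrier_update_iff[OF R_sub]
      by blast
    then have "solvable (?D\<lparr>carrier := R \<inter> D\<rparr>)"
      using solvable_carrier_update_iff[OF sub] by simp
    then show ?thesis
      using gD.solvable_radical_greatest(3)[OF finD norm] unfolding S_def by simp
  qed
  interpret S: normal S G by (rule S(1))
  interpret Q: group "G Mod S" by (rule S.factorgroup_is_group)
  interpret q: group_hom G "G Mod S" "\<lambda>x. S #> x"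
    using S.r_coset_hom_Mod by unfold_locales
  have ker: "kernel G (G Mod S) (\<lambda>x. S #> x) = S"
    using coset_join1[OF _ _ S.subgroup_axioms] coset_join2[OF _ S.subgroup_axioms] S.subset
    by (auto simp: kernel_def FactGroup_def)
  define C where "C = {x \<in> carrier G. \<forall>d\<in>D. (S #> x) \<otimes>\<^bsub>G Mod S\<^esub> (S #> d) = (S #> d) \<otimes>\<^bsub>G Mod S\<^esub> (S #> x)}"
  have C: "C \<lhd> G"
    unfolding C_def by (rule q.normal_relative_centralizer[OF D])
  have "solvable_seq G C"
    unfolding C_def
    by (rule q.solvable_relative_centralizer[OF D der])
      (use ker S(2) solvable_carrier_update_iff[OF S.subgroup_axioms] in simp)
  then have "C \<subseteq> solvable_radical G"
    using solvable_radical_greatest(3)[OF fin C] solvable_carrier_update_iff[OF normal_imp_subgroup[OF C]]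
    by blast
  moreover have "R \<subseteq> C"
  proof
    fix r assume r: "r \<in> R"
    have rc: "r \<in> carrier G"
      using r RH H.mem_carrier by blast
    have "(S #> r) \<otimes>\<^bsub>G Mod S\<^esub> (S #> d) = (S #> d) \<otimes>\<^bsub>G Mod S\<^esub> (S #> r)" if d: "d \<in> D" for d
    proof -
      have dc: "d \<in> carrier G" and dH: "d \<in> H"
        using d D.mem_carrier DH by blast+
      let ?k = "r \<otimes> d \<otimes> inv r \<otimes> inv d"
      \<comment> \<open>Bracketed as \<open>(r d r\<inverse>) d\<inverse>\<close>, the commutator lies in \<open>D\<close>; as \<open>r (d r\<inverse> d\<inverse>)\<close>, in \<open>R\<close>.\<close>
      have "?k \<in> D"
        using D.inv_op_closed2[OF rc d] d by blast
      moreover have "?k \<in> R"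
      proof -
        have "d \<otimes> inv r \<otimes> inv d \<in> R"
          using gH.normal_invE(2)[OF R, of d "inv r"] dH r subgroup.m_inv_closed[OF R_sub r]
            m_inv_consistent[OF H dH] by simp
        then have "r \<otimes> (d \<otimes> inv r \<otimes> inv d) \<in> R"
          using subgroup.m_closed[OF R_sub r] by blast
        then show ?thesis
          using rc dc by (simp add: m_assoc)
      qed
      ultimately have k: "?k \<in> S"
        using RD by blast
      have "inv d \<otimes> (d \<otimes> r) = r"
        using rc dc by (simp add: m_assoc[symmetric])
      then have "r \<otimes> d = ?k \<otimes> (d \<otimes> r)"
        using rc dc by (simp add: m_assoc)
      then have "S #> (r \<otimes> d) = S #> (d \<otimes> r)"
        using coset_mult_assoc[of S ?k "d \<otimes> r"] coset_join2[OF _ S.subgroup_axioms k]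
          S.subset S.mem_carrier[OF k] rc dc by simp
      then show ?thesis
        using rc dc q.hom_mult by metis
    qed
    then show "r \<in> C"
      using rc unfolding C_def by blast
  qed
  ultimately show ?thesis
    unfolding R_def by blast
qed

section \<open>Chains of subgroups\<close>

theorem theorem2:
  fixes G :: "('a, 'b) monoid_scheme" and \<FF> :: "nat monoid set" and A :: "'a set"
  assumes "formation \<FF>" and "subgroup_closed \<FF>" and "solvable_class \<FF>"
    and "group G" and "finite (carrier G)"
    and "subgroup A G" and "solvable (G\<lparr>carrier := A\<rparr>)" and "KF_subnormal \<FF> G A"
  shows "A \<subseteq> solvable_radical G"
proof -
  interpret group G by fact
  obtain n H where H: "H 0 = A" "H n = carrier G" "\<And>i. i \<le> n \<Longrightarrow> subgroup (H i) G"
    and sub: "\<And>i. i < n \<Longrightarrow> H i \<subseteq> H (Suc i)"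
    and step: "\<And>i. i < n \<Longrightarrow> H i \<lhd> G\<lparr>carrier := H (Suc i)\<rparr> \<or>
      residual \<FF> (G\<lparr>carrier := H (Suc i)\<rparr>) \<subseteq> H i"
    using assms(8) unfolding KF_subnormal_def by metis
  have grp: "group (G\<lparr>carrier := H i\<rparr>)" and fin: "finite (carrier (G\<lparr>carrier := H i\<rparr>))"
    if "i \<le> n" for i
    using subgroup.subgroup_is_group[OF H(3)[OF that] is_group]
      subgroup.subset[OF H(3)[OF that]] assms(5) finite_subset by auto
  have cls: "group_class \<FF>"
    using assms(1) by (simp add: formation_def)
  have "A \<subseteq> solvable_radical (G\<lparr>carrier := H i\<rparr>)" if "i \<le> n" for i
    using that
  proof (induction i)
    case 0
    interpret A: group "G\<lparr>carrier := A\<rparr>"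
      using grp[OF 0] H(1) by simp
    show ?case
      using A.solvable_radical_greatest(3)[OF _ A.normal_self] fin[OF 0] assms(7) H(1) by simp
  next
    case (Suc i)
    then have i: "i < n" "i \<le> n" by simp_all
    let ?K = "G\<lparr>carrier := H (Suc i)\<rparr>"
    interpret K: group ?K
      by (rule grp[OF Suc.prems])
    note finK = fin[OF Suc.prems]
    have HK: "subgroup (H i) ?K"
      using subgroup_incl[OF H(3)[OF i(2)] H(3)[OF Suc.prems] sub[OF i(1)]] .
    have "solvable_radical (?K\<lparr>carrier := H i\<rparr>) \<subseteq> solvable_radical ?K"
      using step[OF i(1)]
    proof
      assume "H i \<lhd> ?K"
      then show ?thesis
        using K.solvable_radical_greatest(3)[OF finK] K.solvable_radical_of_normal[OF finK] by blast
    next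
      assume "residual \<FF> ?K \<subseteq> H i"
      then show ?thesis
        using K.residual_contains_derived[OF finK cls assms(3)]
          K.solvable_radical_mono_above_derived[OF finK K.residual_normal _ HK] by blast
    qed
    then show ?case
      using Suc.IH[OF i(2)] by simp
  qed
  from this[of n] show ?thesis
    using H(2) by simp
qed

end
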